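(* Let $\Delta$ be a FOL expressive dynamic theory with finite support, equipped with a sound proof calculus $\vdash_\Delta$ that is complete for propositional and uninterpreted first-order reasoning and contains rule (G) and axioms (K), (V), (B). If, for all first-order $\phi,\psi$ and programs $p$, every $\Delta$-valid formula of the form $\phi\to[p]\psi$ and every $\Delta$-valid formula of the form $\phi\to\langle p\rangle\psi$ is derivable from $\Gamma_\Delta$, then the calculus is relatively complete: every $\Delta$-valid formula $F$ satisfies $\Gamma_\Delta\vdash_\Delta F$, where $\Gamma_\Delta$ is the set of all $\Delta$-valid first-order formulas.
   Context: A dynamic theory $\Delta$ consists of: pairwise disjoint sets $\mathcal V,\mathcal A,\mathcal P$ (variables, atoms, programs); a nonempty set $U$; a nonempty set $S$ of states with $\mathrm{val}:S\times\mathcal V\to U$ satisfying interpolation (for all $\mu,\nu\in S$, $W\subseteq\mathcal V$ there is $\omega$ agreeing with $\mu$ on $W$ and with $\nu$ outside $W$); $\mathcal E_A:\mathcal A\to2^S$, $\mathrm{FV}_A$ with finite values and states agreeing on $\mathrm{FV}_A(a)$ both in or both out of $\mathcal E_A(a)$; $\mathcal E_P:\mathcal P\to2^{S\times S}$, $\mathrm{FV}_P$ with finite values, overapproximation (for $W\supseteq\mathrm{FV}_P(p)$, $\mu=_W\nu$, $(\mu,\omega)\in\mathcal E_P(p)$ there is $\tilde\omega$ with $(\nu,\tilde\omega)\in\mathcal E_P(p)$, $\omega=_W\tilde\omega$) and extensionality; $\mu=_W\nu$ means equal values on all $v\in W$. Formulas $a\mid\neg F\mid F\wedge G\mid\forall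 vF\mid[p]F$, $\langle p\rangle F:=\neg[p]\neg F$, standard Kripke semantics; valid = true in all states; first-order = no boxes. $\mathrm{FV}^{sem},\mathrm{BV}^{sem}$: semantic free variables of formulas/programs and semantic bound variables of programs ($\mathrm{BV}^{sem}(p)$ = variables whose value changes in some transition of $p$); $\mathrm{Vars}(p)=\mathrm{FV}^{sem}(p)\cup\mathrm{BV}^{sem}(p)$. Rules: (G) from $\phi$ infer $[\alpha]\phi$; (K) $[\alpha](\phi\to\psi)\to([\alpha]\phi\to[\alpha]\psi)$; (V) $\phi\to[\alpha]\phi$ if $\mathrm{FV}^{sem}(\phi)\cap\mathrm{BV}^{sem}(\alpha)=\emptyset$; (B) $\forall v[\alpha]\phi\leftrightarrow[\alpha]\forall v\phi$ if $v\notin\mathrm{Vars}(\alpha)$. Finite support: a map $\mathrm{BV}_P$ with finite values and $\mathrm{BV}^{sem}(p)\subseteq\mathrm{BV}_P(p)$. Twin variables: same set of attainable values; twin vectors: equal length, componentwise twins. FOL expressive (with finite support): every variable has infinitely many twins; a map $\doteq$ to first-order formulas with $\mu\models v\doteq w$ iff $\mathrm{val}(\mu,v)=\mathrm{val}(\mu,w)$ for twin $v,w$; and a rendition map $\mathrm S$ such that for every program $p$ and twin vectors $\underline v\supseteq\mathrm{Vars}(p)$, $\underline v^+$ with $\underline v\cap\underline v^+=\emptyset$, $\mathrm S_p(\underline v,\underline v^+)$ is first-order and $\mathrm S_p(\underline v,\underline v^+)\leftrightarrow\langle p\rangle(\underline v\doteq\underline v^+)$ is valid. *)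

theory Defs
  imports Main
begin

section \<open>Syntax\<close>

text \<open>Variables, atoms and programs are elements of three separate types, hence pairwise disjoint.\<close>

datatype ('v, 'a, 'p) fml =
    Atom 'a
  | Neg "('v, 'a, 'p) fml"
  | And "('v, 'a, 'p) fml" "('v, 'a, 'p) fml"
  | All 'v "('v, 'a, 'p) fml"
  | Box 'p "('v, 'a, 'p) fml"

definition Imp :: "('v, 'a, 'p) fml \<Rightarrow> ('v, 'a, 'p) fml \<Rightarrow> ('v, 'a, 'p) fml" where
  "Imp F G = Neg (And F (Neg G))"

definition Iff :: "('v, 'a, 'p) fml \<Rightarrow> ('v, 'a, 'p) fml \<Rightarrow> ('v, 'a, 'p) fml" where
  "Iff F G = And (Imp F G) (Imp G F)"

definition Dia :: "'p \<Rightarrow> ('v, 'a, 'p) fml \<Rightarrow> ('v, 'a, 'p) fml" where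
  "Dia p F = Neg (Box p (Neg F))"

text \<open>The language has no constant for truth; a tautology over an arbitrary atom serves as the
  empty conjunction.\<close>

definition Verum :: "('v, 'a, 'p) fml" where
  "Verum = Imp (Atom (SOME a. True)) (Atom (SOME a. True))"

fun Conj :: "('v, 'a, 'p) fml list \<Rightarrow> ('v, 'a, 'p) fml" where
  "Conj [] = Verum"
| "Conj [F] = F"
| "Conj (F # G # Fs) = And F (Conj (G # Fs))"

primrec first_order :: "('v, 'a, 'p) fml \<Rightarrow> bool" where
  "first_order (Atom a) \<longleftrightarrow> True"
| "first_order (Neg F) \<longleftrightarrow> first_order F"
| "first_order (And F G) \<longleftrightarrow> first_order F \<and> first_order G"
| "first_order (All v F) \<longleftrightarrow> first_order F"
| "first_order (Box p F) \<longleftrightarrow> False"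


section \<open>Dynamic theories\<close>

text \<open>The nonempty sets of values and of states are the types \<open>'u\<close> and \<open>'s\<close>.\<close>

record ('v, 'a, 'p, 'u, 's) dyn_theory =
  val :: "'s \<Rightarrow> 'v \<Rightarrow> 'u"
  EA :: "'a \<Rightarrow> 's set"
  FVA :: "'a \<Rightarrow> 'v set"
  EP :: "'p \<Rightarrow> ('s \<times> 's) set"
  FVP :: "'p \<Rightarrow> 'v set"

definition agree :: "('v, 'a, 'p, 'u, 's) dyn_theory \<Rightarrow> 'v set \<Rightarrow> 's \<Rightarrow> 's \<Rightarrow> bool" where
  "agree \<Delta> W \<mu> \<nu> \<longleftrightarrow> (\<forall>v\<in>W. val \<Delta> \<mu> v = val \<Delta> \<nu> v)"

locale dynamic_theory =
  fixes \<Delta> :: "('v, 'a, 'p, 'u, 's) dyn_theory"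
  assumes interpolation: "\<And>\<mu> \<nu> W. \<exists>\<omega>. agree \<Delta> W \<omega> \<mu> \<and> agree \<Delta> (- W) \<omega> \<nu>"
    and finite_FVA: "\<And>a. finite (FVA \<Delta> a)"
    and atom_coincidence:
      "\<And>a \<mu> \<nu>. agree \<Delta> (FVA \<Delta> a) \<mu> \<nu> \<Longrightarrow> \<mu> \<in> EA \<Delta> a \<longleftrightarrow> \<nu> \<in> EA \<Delta> a"
    and finite_FVP: "\<And>p. finite (FVP \<Delta> p)"
    and overapproximation:
      "\<And>p W \<mu> \<nu> \<omega>. FVP \<Delta> p \<subseteq> W \<Longrightarrow> agree \<Delta> W \<mu> \<nu> \<Longrightarrow> (\<mu>, \<omega>) \<in> EP \<Delta> p \<Longrightarrow>
        \<exists>\<omega>'. (\<nu>, \<omega>') \<in> EP \<Delta> p \<and> agree \<Delta> W \<omega> \<omega>'"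
    and extensionality:
      "\<And>p \<mu> \<mu>' \<omega> \<omega>'. agree \<Delta> UNIV \<mu> \<mu>' \<Longrightarrow> agree \<Delta> UNIV \<omega> \<omega>' \<Longrightarrow>
        (\<mu>, \<omega>) \<in> EP \<Delta> p \<Longrightarrow> (\<mu>', \<omega>') \<in> EP \<Delta> p"

primrec sat :: "('v, 'a, 'p, 'u, 's) dyn_theory \<Rightarrow> 's \<Rightarrow> ('v, 'a, 'p) fml \<Rightarrow> bool" where
  "sat \<Delta> \<mu> (Atom a) \<longleftrightarrow> \<mu> \<in> EA \<Delta> a"
| "sat \<Delta> \<mu> (Neg F) \<longleftrightarrow> \<not> sat \<Delta> \<mu> F"
| "sat \<Delta> \<mu> (And F G) \<longleftrightarrow> sat \<Delta> \<mu> F \<and> sat \<Delta> \<mu> G"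
| "sat \<Delta> \<mu> (All v F) \<longleftrightarrow> (\<forall>\<nu>. agree \<Delta> (- {v}) \<mu> \<nu> \<longrightarrow> sat \<Delta> \<nu> F)"
| "sat \<Delta> \<mu> (Box p F) \<longleftrightarrow> (\<forall>\<nu>. (\<mu>, \<nu>) \<in> EP \<Delta> p \<longrightarrow> sat \<Delta> \<nu> F)"

definition valid :: "('v, 'a, 'p, 'u, 's) dyn_theory \<Rightarrow> ('v, 'a, 'p) fml \<Rightarrow> bool" where
  "valid \<Delta> F \<longleftrightarrow> (\<forall>\<mu>. sat \<Delta> \<mu> F)"

definition fo_validities :: "('v, 'a, 'p, 'u, 's) dyn_theory \<Rightarrow> ('v, 'a, 'p) fml set" where
  "fo_validities \<Delta> = {F. first_order F \<and> valid \<Delta> F}"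


section \<open>Semantic free and bound variables\<close>

definition FVsem :: "('v, 'a, 'p, 'u, 's) dyn_theory \<Rightarrow> ('v, 'a, 'p) fml \<Rightarrow> 'v set" where
  "FVsem \<Delta> F = {v. \<exists>\<mu> \<nu>. agree \<Delta> (- {v}) \<mu> \<nu> \<and> sat \<Delta> \<mu> F \<and> \<not> sat \<Delta> \<nu> F}"

definition FVsem_prog :: "('v, 'a, 'p, 'u, 's) dyn_theory \<Rightarrow> 'p \<Rightarrow> 'v set" where
  "FVsem_prog \<Delta> p = {v. \<exists>\<mu> \<nu> \<omega>. agree \<Delta> (- {v}) \<mu> \<nu> \<and> (\<mu>, \<omega>) \<in> EP \<Delta> p \<and>
     \<not> (\<exists>\<omega>'. (\<nu>, \<omega>') \<in> EP \<Delta> p \<and> agree \<Delta> (- {v}) \<omega> \<omega>')}"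

definition BVsem :: "('v, 'a, 'p, 'u, 's) dyn_theory \<Rightarrow> 'p \<Rightarrow> 'v set" where
  "BVsem \<Delta> p = {v. \<exists>\<mu> \<omega>. (\<mu>, \<omega>) \<in> EP \<Delta> p \<and> val \<Delta> \<mu> v \<noteq> val \<Delta> \<omega> v}"

definition Vars :: "('v, 'a, 'p, 'u, 's) dyn_theory \<Rightarrow> 'p \<Rightarrow> 'v set" where
  "Vars \<Delta> p = FVsem_prog \<Delta> p \<union> BVsem \<Delta> p"


section \<open>Finite support and FOL expressiveness\<close>

locale finite_support = dynamic_theory \<Delta>
  for \<Delta> :: "('v, 'a, 'p, 'u, 's) dyn_theory" +
  fixes BVP :: "'p \<Rightarrow> 'v set"
  assumes finite_BVP: "\<And>p. finite (BVP p)"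
    and BVsem_subset: "\<And>p. BVsem \<Delta> p \<subseteq> BVP p"

definition twin :: "('v, 'a, 'p, 'u, 's) dyn_theory \<Rightarrow> 'v \<Rightarrow> 'v \<Rightarrow> bool" where
  "twin \<Delta> v w \<longleftrightarrow> range (\<lambda>\<mu>. val \<Delta> \<mu> v) = range (\<lambda>\<mu>. val \<Delta> \<mu> w)"

definition twins :: "('v, 'a, 'p, 'u, 's) dyn_theory \<Rightarrow> 'v list \<Rightarrow> 'v list \<Rightarrow> bool" where
  "twins \<Delta> vs ws \<longleftrightarrow> list_all2 (twin \<Delta>) vs ws"

definition vec_eq ::
    "('v \<Rightarrow> 'v \<Rightarrow> ('v, 'a, 'p) fml) \<Rightarrow> 'v list \<Rightarrow> 'v list \<Rightarrow> ('v, 'a, 'p) fml" where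
  "vec_eq eq vs ws = Conj (map2 eq vs ws)"

locale fol_expressive = finite_support \<Delta> BVP
  for \<Delta> :: "('v, 'a, 'p, 'u, 's) dyn_theory" and BVP :: "'p \<Rightarrow> 'v set" +
  fixes eq :: "'v \<Rightarrow> 'v \<Rightarrow> ('v, 'a, 'p) fml"
    and S :: "'p \<Rightarrow> 'v list \<Rightarrow> 'v list \<Rightarrow> ('v, 'a, 'p) fml"
  assumes infinite_twins: "\<And>v. infinite {w. twin \<Delta> v w}"
    and eq_first_order: "\<And>v w. twin \<Delta> v w \<Longrightarrow> first_order (eq v w)"
    and eq_sat:
      "\<And>v w \<mu>. twin \<Delta> v w \<Longrightarrow> sat \<Delta> \<mu> (eq v w) \<longleftrightarrow> val \<Delta> \<mu> v = val \<Delta> \<mu> w"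
    and rendition_first_order:
      "\<And>p vs ws. twins \<Delta> vs ws \<Longrightarrow> Vars \<Delta> p \<subseteq> set vs \<Longrightarrow> set vs \<inter> set ws = {} \<Longrightarrow>
        first_order (S p vs ws)"
    and rendition_valid:
      "\<And>p vs ws. twins \<Delta> vs ws \<Longrightarrow> Vars \<Delta> p \<subseteq> set vs \<Longrightarrow> set vs \<inter> set ws = {} \<Longrightarrow>
        valid \<Delta> (Iff (S p vs ws) (Dia p (vec_eq eq vs ws)))"


section \<open>Propositional and uninterpreted first-order consequence\<close>

text \<open>Propositional reasoning: everything but negation and conjunction is opaque.\<close>

definition prop_consequence :: "('v, 'a, 'p) fml set \<Rightarrow> ('v, 'a, 'p) fml \<Rightarrow> bool" where
  "prop_consequence \<Theta> F \<longleftrightarrow>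
     (\<forall>h. (\<forall>G. h (Neg G) \<longleftrightarrow> \<not> h G) \<and> (\<forall>G H. h (And G H) \<longleftrightarrow> h G \<and> h H) \<longrightarrow>
       (\<forall>G\<in>\<Theta>. h G) \<longrightarrow> h F)"

text \<open>Uninterpreted first-order reasoning: an atom \<open>a\<close> is an uninterpreted predicate of the
  variables \<open>FVA \<Delta> a\<close>, and a box formula is an opaque predicate of the whole assignment (nothing
  is assumed about which variables it depends on, so that fewer consequences are required to be
  derivable than if such dependencies were taken into account).\<close>

primrec usat ::
    "('a \<Rightarrow> ('v \<Rightarrow> 'd) \<Rightarrow> bool) \<Rightarrow> ('p \<Rightarrow> ('v, 'a, 'p) fml \<Rightarrow> ('v \<Rightarrow> 'd) \<Rightarrow> bool) \<Rightarrow>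
     ('v \<Rightarrow> 'd) \<Rightarrow> ('v, 'a, 'p) fml \<Rightarrow> bool" where
  "usat IA IB \<sigma> (Atom a) \<longleftrightarrow> IA a \<sigma>"
| "usat IA IB \<sigma> (Neg F) \<longleftrightarrow> \<not> usat IA IB \<sigma> F"
| "usat IA IB \<sigma> (And F G) \<longleftrightarrow> usat IA IB \<sigma> F \<and> usat IA IB \<sigma> G"
| "usat IA IB \<sigma> (All v F) \<longleftrightarrow> (\<forall>d. usat IA IB (\<sigma>(v := d)) F)"
| "usat IA IB \<sigma> (Box p F) \<longleftrightarrow> IB p F \<sigma>"

text \<open>By Loewenheim-Skolem, and since there is no built-in equality, it suffices to consider
  structures with domain \<open>nat\<close>. Premises are read universally, i.e. as true under all
  assignments, so that generalization is a first-order inference.\<close>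

definition fo_consequence ::
    "('v, 'a, 'p, 'u, 's) dyn_theory \<Rightarrow> ('v, 'a, 'p) fml set \<Rightarrow> ('v, 'a, 'p) fml \<Rightarrow> bool" where
  "fo_consequence \<Delta> \<Theta> F \<longleftrightarrow>
     (\<forall>(IA :: 'a \<Rightarrow> ('v \<Rightarrow> nat) \<Rightarrow> bool) IB.
       (\<forall>a \<sigma> \<tau>. (\<forall>v\<in>FVA \<Delta> a. \<sigma> v = \<tau> v) \<longrightarrow> IA a \<sigma> = IA a \<tau>) \<longrightarrow>
       (\<forall>G\<in>\<Theta>. \<forall>\<sigma>. usat IA IB \<sigma> G) \<longrightarrow> (\<forall>\<sigma>. usat IA IB \<sigma> F))"


section \<open>Proof calculi\<close>

text \<open>\<open>prv \<Gamma> F\<close>: the formula \<open>F\<close> is derivable in the calculus using the members of \<open>\<Gamma>\<close> as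
  additional axioms. As rule (G) only preserves validity, soundness refers to validity, too.\<close>

locale proof_calculus = dynamic_theory \<Delta>
  for \<Delta> :: "('v, 'a, 'p, 'u, 's) dyn_theory" +
  fixes prv :: "('v, 'a, 'p) fml set \<Rightarrow> ('v, 'a, 'p) fml \<Rightarrow> bool"
  assumes assumption: "\<And>\<Gamma> F. F \<in> \<Gamma> \<Longrightarrow> prv \<Gamma> F"
    and sound: "\<And>\<Gamma> F. prv \<Gamma> F \<Longrightarrow> (\<And>G. G \<in> \<Gamma> \<Longrightarrow> valid \<Delta> G) \<Longrightarrow> valid \<Delta> F"
    and prop_complete:
      "\<And>\<Gamma> \<Theta> F. finite \<Theta> \<Longrightarrow> (\<And>G. G \<in> \<Theta> \<Longrightarrow> prv \<Gamma> G) \<Longrightarrow> prop_consequence \<Theta> F \<Longrightarrow> prv \<Gamma> F"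
    and fo_complete:
      "\<And>\<Gamma> \<Theta> F. finite \<Theta> \<Longrightarrow> (\<And>G. G \<in> \<Theta> \<Longrightarrow> prv \<Gamma> G) \<Longrightarrow> fo_consequence \<Delta> \<Theta> F \<Longrightarrow> prv \<Gamma> F"
    and rule_G: "\<And>\<Gamma> p F. prv \<Gamma> F \<Longrightarrow> prv \<Gamma> (Box p F)"
    and axiom_K: "\<And>\<Gamma> p F G. prv \<Gamma> (Imp (Box p (Imp F G)) (Imp (Box p F) (Box p G)))"
    and axiom_V: "\<And>\<Gamma> p F. FVsem \<Delta> F \<inter> BVsem \<Delta> p = {} \<Longrightarrow> prv \<Gamma> (Imp F (Box p F))"
    and axiom_B: "\<And>\<Gamma> v p F. v \<notin> Vars \<Delta> p \<Longrightarrow> prv \<Gamma> (Iff (All v (Box p F)) (Box p (All v F)))"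

end

(*
  Every formula is provably equivalent to a first-order one. The only interesting case of the
  induction is a box over a first-order formula \<psi>: with v listing Vars p and v+ fresh twins of v,
  [p]\<psi> is semantically equivalent to
    \<forall>v+ (S_p(v, v+) \<rightarrow> \<forall>v (v = v+ \<rightarrow> \<psi>)).
  The two assumed completeness properties, applied to this formula and to its negation,
  turn the semantic equivalence into a derivable one.
*)
theory Submission
  imports Defs
begin

section \<open>Semantics of the derived connectives\<close>

lemma agree_sym: "agree \<Delta> W \<mu> \<nu> \<Longrightarrow> agree \<Delta> W \<nu> \<mu>"
  by (simp add: agree_def)

lemma sat_Imp [simp]: "sat \<Delta> \<mu> (Imp F G) \<longleftrightarrow> (sat \<Delta> \<mu> F \<longrightarrow> sat \<Delta> \<mu> G)"
  by (simp add: Imp_def)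

lemma sat_Iff [simp]: "sat \<Delta> \<mu> (Iff F G) \<longleftrightarrow> (sat \<Delta> \<mu> F \<longleftrightarrow> sat \<Delta> \<mu> G)"
  by (auto simp: Iff_def)

lemma sat_Dia [simp]: "sat \<Delta> \<mu> (Dia p F) \<longleftrightarrow> (\<exists>\<nu>. (\<mu>, \<nu>) \<in> EP \<Delta> p \<and> sat \<Delta> \<nu> F)"
  by (simp add: Dia_def)

lemma sat_Conj [simp]: "sat \<Delta> \<mu> (Conj Fs) \<longleftrightarrow> (\<forall>F\<in>set Fs. sat \<Delta> \<mu> F)"
  by (induction Fs rule: Conj.induct) (auto simp: Verum_def)

lemma first_order_Imp [simp]: "first_order (Imp F G) \<longleftrightarrow> first_order F \<and> first_order G"
  by (simp add: Imp_def)

lemma first_order_Conj: "(\<And>F. F \<in> set Fs \<Longrightarrow> first_order F) \<Longrightarrow> first_order (Conj Fs)"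
  by (induction Fs rule: Conj.induct) (auto simp: Verum_def)

abbreviation Alls :: "'v list \<Rightarrow> ('v, 'a, 'p) fml \<Rightarrow> ('v, 'a, 'p) fml" where
  "Alls vs F \<equiv> foldr All vs F"

lemma first_order_Alls [simp]: "first_order (Alls vs F) \<longleftrightarrow> first_order F"
  by (induction vs) auto

text \<open>The value at boxes is irrelevant: only first-order formulas are considered.\<close>

primrec fvars :: "('v, 'a, 'p, 'u, 's) dyn_theory \<Rightarrow> ('v, 'a, 'p) fml \<Rightarrow> 'v set" where
  "fvars \<Delta> (Atom a) = FVA \<Delta> a"
| "fvars \<Delta> (Neg F) = fvars \<Delta> F"
| "fvars \<Delta> (And F G) = fvars \<Delta> F \<union> fvars \<Delta> G"
| "fvars \<Delta> (All v F) = fvars \<Delta> F - {v}"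
| "fvars \<Delta> (Box p F) = {}"

section \<open>Coincidence, quantifier prefixes and copying into twin variables\<close>

context dynamic_theory
begin

lemma finite_fvars: "finite (fvars \<Delta> F)"
  by (induction F) (auto simp: finite_FVA)

lemma sat_coincidence:
  assumes "first_order F" and "agree \<Delta> (fvars \<Delta> F) \<mu> \<nu>"
  shows "sat \<Delta> \<mu> F \<longleftrightarrow> sat \<Delta> \<nu> F"
  using assms
proof (induction F arbitrary: \<mu> \<nu>)
  case (Atom a)
  then show ?case using atom_coincidence by simp
next
  case (Neg F)
  then show ?case by simp
next
  case (And F G)
  have "agree \<Delta> (fvars \<Delta> F) \<mu> \<nu>" and "agree \<Delta> (fvars \<Delta> G) \<mu> \<nu>"
    using And.prems by (auto simp: agree_def)
  then show ?case using And by simp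
next
  case (All v F)
  have transfer: "sat \<Delta> \<beta> (All v F)"
    if sat: "sat \<Delta> \<alpha> (All v F)" and agr: "agree \<Delta> (fvars \<Delta> F - {v}) \<alpha> \<beta>" for \<alpha> \<beta>
    unfolding sat.simps
  proof (intro allI impI)
    fix \<kappa>
    assume \<kappa>: "agree \<Delta> (- {v}) \<beta> \<kappa>"
    \<comment> \<open>This \<omega> is a \<open>v\<close>-variant of \<alpha>, so the quantifier
      applies to it. On the other free variables of \<open>F\<close> it agrees with \<kappa> by way
      of \<alpha> and \<beta>.\<close>
    obtain \<omega> where \<omega>: "agree \<Delta> {v} \<omega> \<kappa>" "agree \<Delta> (- {v}) \<omega> \<alpha>"
      using interpolation by blast
    have "sat \<Delta> \<omega> F"
      using sat agree_sym[OF \<omega>(2)] by simp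
    moreover have "agree \<Delta> (fvars \<Delta> F) \<omega> \<kappa>"
      using \<kappa> \<omega> agr unfolding agree_def by (metis ComplI Diff_iff)
    ultimately show "sat \<Delta> \<kappa> F"
      using All by simp
  qed
  show ?case
    using transfer[of \<mu> \<nu>] transfer[of \<nu> \<mu>] All.prems(2) agree_sym[OF All.prems(2)]
    unfolding fvars.simps by blast
next
  case (Box p F)
  then show ?case by simp
qed

text \<open>Distinct states may agree on every variable, so even the empty prefix relies on
  coincidence. For a longer prefix, interpolation yields the intermediate state reached by the
  outermost quantifier.\<close>

lemma sat_Alls: "sat \<Delta> \<mu> (Alls vs F) \<longleftrightarrow> (\<forall>\<nu>. agree \<Delta> (- set vs) \<mu> \<nu> \<longrightarrow> sat \<Delta> \<nu> F)"
  if "first_order F"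
proof (induction vs arbitrary: \<mu>)
  case Nil
  have "sat \<Delta> \<nu> F" if "agree \<Delta> UNIV \<mu> \<nu>" "sat \<Delta> \<mu> F" for \<nu>
    using sat_coincidence[OF \<open>first_order F\<close>, of \<mu> \<nu>] that by (auto simp: agree_def)
  then show ?case by (auto simp: agree_def)
next
  case (Cons v vs)
  show ?case
  proof
    assume L: "sat \<Delta> \<mu> (Alls (v # vs) F)"
    show "\<forall>\<nu>. agree \<Delta> (- set (v # vs)) \<mu> \<nu> \<longrightarrow> sat \<Delta> \<nu> F"
    proof (intro allI impI)
      fix \<nu>
      assume \<nu>: "agree \<Delta> (- set (v # vs)) \<mu> \<nu>"
      obtain \<omega> where \<omega>: "agree \<Delta> {v} \<omega> \<nu>" "agree \<Delta> (- {v}) \<omega> \<mu>"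
        using interpolation by blast
      have "agree \<Delta> (- set vs) \<omega> \<nu>"
        using \<nu> \<omega> by (force simp: agree_def)
      then show "sat \<Delta> \<nu> F"
        using L Cons.IH agree_sym[OF \<omega>(2)] by simp
    qed
  next
    assume "\<forall>\<nu>. agree \<Delta> (- set (v # vs)) \<mu> \<nu> \<longrightarrow> sat \<Delta> \<nu> F"
    then show "sat \<Delta> \<mu> (Alls (v # vs) F)"
      using Cons.IH by (auto simp: agree_def)
  qed
qed

text \<open>A variable outside \<open>FVP\<close> is handled by overapproximation over the
  complement of that variable. The inclusion serves to bound \<open>Vars\<close> by a finite set, so
  that it can be listed as a vector.\<close>

lemma FVsem_prog_subset: "FVsem_prog \<Delta> p \<subseteq> FVP \<Delta> p"
proof
  fix v
  assume v: "v \<in> FVsem_prog \<Delta> p"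
  show "v \<in> FVP \<Delta> p"
  proof (rule ccontr)
    assume "v \<notin> FVP \<Delta> p"
    then have "FVP \<Delta> p \<subseteq> - {v}" by blast
    then show False
      using v overapproximation unfolding FVsem_prog_def by blast
  qed
qed

lemma agree_off_BVsem: "(\<mu>, \<omega>) \<in> EP \<Delta> p \<Longrightarrow> v \<notin> BVsem \<Delta> p \<Longrightarrow> val \<Delta> \<mu> v = val \<Delta> \<omega> v"
  by (auto simp: BVsem_def)

text \<open>Each value read from \<omega> is attained by the twin in some state, and interpolation
  transplants it from there. Distinctness of \<open>ws\<close> keeps one write from destroying
  another.\<close>

lemma copy_to_twins:
  assumes "twins \<Delta> vs ws" and "distinct ws"
  shows "\<exists>\<nu>. agree \<Delta> (- set ws) \<mu> \<nu> \<and> list_all2 (\<lambda>v w. val \<Delta> \<omega> v = val \<Delta> \<nu> w) vs ws"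
  using assms(1)[unfolded twins_def] assms(2)
proof (induction rule: list_all2_induct)
  case Nil
  then show ?case by (auto simp: agree_def)
next
  case (Cons v vs w ws)
  then obtain \<nu> where \<nu>: "agree \<Delta> (- set ws) \<mu> \<nu>"
      "list_all2 (\<lambda>v w. val \<Delta> \<omega> v = val \<Delta> \<nu> w) vs ws"
    by auto
  obtain \<kappa> where \<kappa>: "val \<Delta> \<kappa> w = val \<Delta> \<omega> v"
    using Cons.hyps(1) unfolding twin_def by (metis rangeE rangeI)
  obtain \<nu>' where \<nu>': "agree \<Delta> {w} \<nu>' \<kappa>" "agree \<Delta> (- {w}) \<nu>' \<nu>"
    using interpolation by blast
  have "list_all2 (\<lambda>v w. val \<Delta> \<omega> v = val \<Delta> \<nu>' w) vs ws"
    by (rule list.rel_mono_strong[OF \<nu>(2)]) (use \<nu>'(2) Cons.prems in \<open>force simp: agree_def\<close>)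
  moreover have "agree \<Delta> (- set (w # ws)) \<mu> \<nu>'"
    using \<nu>(1) \<nu>'(2) by (auto simp: agree_def)
  moreover have "val \<Delta> \<omega> v = val \<Delta> \<nu>' w"
    using \<kappa> \<nu>'(1) by (auto simp: agree_def)
  ultimately show ?case by auto
qed

end

lemma (in finite_support) finite_Vars: "finite (Vars \<Delta> p)"
  using finite_subset[OF FVsem_prog_subset finite_FVP] finite_subset[OF BVsem_subset finite_BVP]
  by (simp add: Vars_def)

section \<open>First-order definability of boxes\<close>

context fol_expressive
begin

lemma fresh_twins:
  assumes "finite A"
  shows "\<exists>ws. twins \<Delta> vs ws \<and> distinct ws \<and> set ws \<inter> A = {}"
proof (induction vs)
  case Nil
  then show ?case by (auto simp: twins_def)
next
  case (Cons v vs)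
  then obtain ws where ws: "twins \<Delta> vs ws" "distinct ws" "set ws \<inter> A = {}"
    by blast
  have "finite (A \<union> set ws)"
    using assms by simp
  from Diff_infinite_finite[OF this infinite_twins]
  obtain w where "twin \<Delta> v w" "w \<notin> A" "w \<notin> set ws"
    by (metis (no_types, lifting) Diff_iff UnCI all_not_in_conv finite.emptyI mem_Collect_eq)
  then show ?case
    using ws by (intro exI[of _ "w # ws"]) (auto simp: twins_def)
qed

lemma first_order_vec_eq: "twins \<Delta> vs ws \<Longrightarrow> first_order (vec_eq eq vs ws)"
  unfolding vec_eq_def twins_def
  by (rule first_order_Conj) (auto simp: list_all2_iff intro: eq_first_order)

lemma sat_vec_eq:
  "twins \<Delta> vs ws \<Longrightarrow>
    sat \<Delta> \<mu> (vec_eq eq vs ws) \<longleftrightarrow> list_all2 (\<lambda>v w. val \<Delta> \<mu> v = val \<Delta> \<mu> w) vs ws"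
  unfolding vec_eq_def twins_def
  by (induction rule: list_all2_induct) (simp_all add: eq_sat Verum_def)

text \<open>The twins \<open>ws\<close> are a ghost copy of the output: \<open>p\<close> neither
  reads nor writes them, so they hold guessed final values throughout a run. The rendition says that
  some run ends with these values in \<open>vs\<close>, and assigning them to \<open>vs\<close>
  rebuilds its final state up to extensional equality.\<close>

lemma Box_first_order_definable:
  assumes fo: "first_order \<psi>"
  shows "\<exists>\<chi>. first_order \<chi> \<and> valid \<Delta> (Iff \<chi> (Box p \<psi>))"
proof -
  obtain vs where vs: "set vs = Vars \<Delta> p"
    using finite_Vars finite_list by blast
  \<comment> \<open>Avoiding \<open>Vars\<close> meets the side condition of the rendition and keeps
    \<open>ws\<close> constant along runs. Avoiding \<open>FVP\<close> lets runs be transferred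
    between states that differ only on \<open>ws\<close>, and avoiding \<open>fvars\<close> makes
    \<psi> insensitive to such differences.\<close>
  obtain ws where tw: "twins \<Delta> vs ws" and "distinct ws"
      and fresh: "set ws \<inter> (Vars \<Delta> p \<union> FVP \<Delta> p \<union> fvars \<Delta> \<psi>) = {}"
    using fresh_twins[of "Vars \<Delta> p \<union> FVP \<Delta> p \<union> fvars \<Delta> \<psi>" vs]
    by (auto simp: finite_Vars finite_FVP finite_fvars)
  have disj: "set vs \<inter> set ws = {}"
    using fresh vs by auto
  define \<chi> where "\<chi> = Alls ws (Imp (S p vs ws) (Alls vs (Imp (vec_eq eq vs ws) \<psi>)))"
  have fo_S: "first_order (S p vs ws)"
    using rendition_first_order[OF tw _ disj] vs by simp
  have sat_S: "sat \<Delta> \<mu> (S p vs ws) \<longleftrightarrow> (\<exists>\<omega>. (\<mu>, \<omega>) \<in> EP \<Delta> p \<and>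
      list_all2 (\<lambda>v w. val \<Delta> \<omega> v = val \<Delta> \<omega> w) vs ws)" for \<mu>
    using rendition_valid[OF tw _ disj] vs by (auto simp: valid_def sat_vec_eq[OF tw])
  have fo_vec: "first_order (vec_eq eq vs ws)"
    by (rule first_order_vec_eq[OF tw])
  have sat_\<chi>: "sat \<Delta> \<mu> \<chi> \<longleftrightarrow> (\<forall>\<nu>. agree \<Delta> (- set ws) \<mu> \<nu> \<longrightarrow> sat \<Delta> \<nu> (S p vs ws) \<longrightarrow>
      (\<forall>\<kappa>. agree \<Delta> (- set vs) \<nu> \<kappa> \<longrightarrow>
        list_all2 (\<lambda>v w. val \<Delta> \<kappa> v = val \<Delta> \<kappa> w) vs ws \<longrightarrow> sat \<Delta> \<kappa> \<psi>))" for \<mu>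
    unfolding \<chi>_def using fo_S fo_vec fo by (simp add: sat_Alls sat_vec_eq[OF tw])
  have step: "\<exists>\<omega>'. (\<nu>, \<omega>') \<in> EP \<Delta> p \<and> agree \<Delta> (- set ws) \<omega> \<omega>'"
    if "agree \<Delta> (- set ws) \<mu> \<nu>" "(\<mu>, \<omega>) \<in> EP \<Delta> p" for \<mu> \<nu> \<omega>
    by (rule overapproximation[OF _ that]) (use fresh in blast)
  have \<psi>_cong: "sat \<Delta> \<mu> \<psi> \<longleftrightarrow> sat \<Delta> \<nu> \<psi>" if "agree \<Delta> (- set ws) \<mu> \<nu>" for \<mu> \<nu>
    by (rule sat_coincidence[OF fo]) (use fresh that in \<open>auto simp: agree_def\<close>)
  have off_vs: "agree \<Delta> (- set vs) \<mu> \<omega>" if "(\<mu>, \<omega>) \<in> EP \<Delta> p" for \<mu> \<omega>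
    using agree_off_BVsem[OF that] vs by (auto simp: agree_def Vars_def)
  have "sat \<Delta> \<mu> \<chi> \<longleftrightarrow> sat \<Delta> \<mu> (Box p \<psi>)" for \<mu>
  proof
    assume \<chi>: "sat \<Delta> \<mu> \<chi>"
    show "sat \<Delta> \<mu> (Box p \<psi>)"
      unfolding sat.simps
    proof (intro allI impI)
      fix \<omega>
      assume \<omega>: "(\<mu>, \<omega>) \<in> EP \<Delta> p"
      \<comment> \<open>The final values of the given run are stored in \<open>ws\<close> before the
        run is repeated from \<nu>.\<close>
      obtain \<nu> where \<nu>: "agree \<Delta> (- set ws) \<mu> \<nu>"
          "list_all2 (\<lambda>v w. val \<Delta> \<omega> v = val \<Delta> \<nu> w) vs ws"
        using copy_to_twins[OF tw \<open>distinct ws\<close>] by blast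
      obtain \<omega>' where \<omega>': "(\<nu>, \<omega>') \<in> EP \<Delta> p" "agree \<Delta> (- set ws) \<omega> \<omega>'"
        using step[OF \<nu>(1) \<omega>] by blast
      have "list_all2 (\<lambda>v w. val \<Delta> \<omega>' v = val \<Delta> \<omega>' w) vs ws"
      proof (rule list.rel_mono_strong[OF \<nu>(2)])
        fix v w
        assume "v \<in> set vs" "w \<in> set ws" and eq: "val \<Delta> \<omega> v = val \<Delta> \<nu> w"
        then have "v \<notin> set ws" "w \<notin> set vs"
          using disj by auto
        then show "val \<Delta> \<omega>' v = val \<Delta> \<omega>' w"
          using eq \<omega>'(2) off_vs[OF \<omega>'(1)] by (simp add: agree_def)
      qed
      \<comment> \<open>The inner quantifier is instantiated with \<omega>' itself, which differs
        from \<nu> only on \<open>vs\<close>.\<close>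
      then have "sat \<Delta> \<omega>' \<psi>"
        using \<chi> \<nu>(1) \<omega>'(1) off_vs sat_S sat_\<chi> by blast
      then show "sat \<Delta> \<omega> \<psi>"
        using \<psi>_cong \<omega>'(2) by blast
    qed
  next
    assume box: "sat \<Delta> \<mu> (Box p \<psi>)"
    show "sat \<Delta> \<mu> \<chi>"
      unfolding sat_\<chi> sat_S
    proof (intro allI impI, elim exE conjE)
      fix \<nu> \<kappa> \<omega>
      assume \<nu>: "agree \<Delta> (- set ws) \<mu> \<nu>"
        and \<kappa>: "agree \<Delta> (- set vs) \<nu> \<kappa>" "list_all2 (\<lambda>v w. val \<Delta> \<kappa> v = val \<Delta> \<kappa> w) vs ws"
        and \<omega>: "(\<nu>, \<omega>) \<in> EP \<Delta> p" "list_all2 (\<lambda>v w. val \<Delta> \<omega> v = val \<Delta> \<omega> w) vs ws"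
      have off: "val \<Delta> \<kappa> v = val \<Delta> \<omega> v" if "v \<notin> set vs" for v
        using that \<kappa>(1) off_vs[OF \<omega>(1)] by (simp add: agree_def)
      \<comment> \<open>By \<open>off\<close> both states have the same values on \<open>ws\<close>,
        which lies outside \<open>vs\<close>. In each of them \<open>vs\<close> repeats these values
        componentwise.\<close>
      have "val \<Delta> \<kappa> v = val \<Delta> \<omega> v" if "v \<in> set vs" for v
      proof -
        obtain i where i: "i < length vs" "v = vs ! i"
          using \<open>v \<in> set vs\<close> by (auto simp: in_set_conv_nth)
        then have "ws ! i \<notin> set vs"
          using \<kappa>(2) disj by (auto simp: list_all2_conv_all_nth disjoint_iff)
        then show ?thesis
          using off i \<kappa>(2) \<omega>(2) by (simp add: list_all2_conv_all_nth)
      qed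
      then have "sat \<Delta> \<kappa> \<psi> \<longleftrightarrow> sat \<Delta> \<omega> \<psi>"
        using off by (intro sat_coincidence[OF fo]) (auto simp: agree_def)
      \<comment> \<open>The run from \<nu> is moved back to \<mu>, where the box is known to hold;
        its new endpoint differs from \<omega> at most on \<open>ws\<close>.\<close>
      moreover obtain \<omega>' where "(\<mu>, \<omega>') \<in> EP \<Delta> p" "agree \<Delta> (- set ws) \<omega> \<omega>'"
        using step[OF agree_sym[OF \<nu>] \<omega>(1)] by blast
      ultimately show "sat \<Delta> \<kappa> \<psi>"
        using box \<psi>_cong by auto
    qed
  qed
  then have "valid \<Delta> (Iff \<chi> (Box p \<psi>))"
    by (simp add: valid_def)
  moreover have "first_order \<chi>"
    by (simp add: \<chi>_def fo fo_S fo_vec)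
  ultimately show ?thesis by blast
qed

end

section \<open>Derived congruences and reduction to first-order formulas\<close>

context proof_calculus
begin

lemma prv_prop:
  assumes "list_all (prv \<Gamma>) Fs" and "prop_consequence (set Fs) F"
  shows "prv \<Gamma> F"
  using prop_complete[of "set Fs" \<Gamma> F] assms by (simp add: list_all_iff)

text \<open>Necessitation by (G), followed by distribution by (K).\<close>

lemma prv_Box_mono: "prv \<Gamma> (Imp F G) \<Longrightarrow> prv \<Gamma> (Imp (Box p F) (Box p G))"
  by (rule prv_prop[of _ "[Box p (Imp F G), Imp (Box p (Imp F G)) (Imp (Box p F) (Box p G))]"])
    (simp add: rule_G axiom_K, auto simp: prop_consequence_def Imp_def)

lemma prv_Box_cong:
  assumes "prv \<Gamma> (Iff F G)"
  shows "prv \<Gamma> (Iff (Box p F) (Box p G))"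
proof -
  have "prv \<Gamma> (Imp F G)"
    by (rule prv_prop[of _ "[Iff F G]"]) (simp add: assms, simp add: prop_consequence_def Iff_def)
  moreover have "prv \<Gamma> (Imp G F)"
    by (rule prv_prop[of _ "[Iff F G]"]) (simp add: assms, simp add: prop_consequence_def Iff_def)
  ultimately show ?thesis
    by (intro prv_prop[of _ "[Imp (Box p F) (Box p G), Imp (Box p G) (Box p F)]"])
      (simp add: prv_Box_mono, simp add: prop_consequence_def Iff_def)
qed

text \<open>Premises of \<open>fo_consequence\<close> are read under all assignments, so the
  equivalence is available at every updated assignment.\<close>

lemma prv_All_cong: "prv \<Gamma> (Iff F G) \<Longrightarrow> prv \<Gamma> (Iff (All v F) (All v G))"
  by (rule fo_complete[of "{Iff F G}"]) (auto simp: fo_consequence_def Iff_def Imp_def)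

text \<open>Definability enters as a hypothesis since this locale knows nothing of expressiveness.
  In the box case the body is first replaced by its first-order equivalent, which brings the formula
  within reach of \<open>box\<close> and \<open>dia\<close>.\<close>

lemma prv_Iff_first_order:
  assumes definable: "\<And>p \<psi>. first_order \<psi> \<Longrightarrow>
      \<exists>\<chi>. first_order \<chi> \<and> valid \<Delta> (Iff \<chi> (Box p \<psi>))"
    and box: "\<And>\<phi> \<psi> p. first_order \<phi> \<Longrightarrow> first_order \<psi> \<Longrightarrow> valid \<Delta> (Imp \<phi> (Box p \<psi>)) \<Longrightarrow>
      prv \<Gamma> (Imp \<phi> (Box p \<psi>))"
    and dia: "\<And>\<phi> \<psi> p. first_order \<phi> \<Longrightarrow> first_order \<psi> \<Longrightarrow> valid \<Delta> (Imp \<phi> (Dia p \<psi>)) \<Longrightarrow>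
      prv \<Gamma> (Imp \<phi> (Dia p \<psi>))"
  shows "\<exists>G. first_order G \<and> prv \<Gamma> (Iff F G)"
proof (induction F)
  case (Atom a)
  have "prv \<Gamma> (Iff (Atom a) (Atom a))"
    by (rule prv_prop[of _ "[]"]) (auto simp: prop_consequence_def Iff_def Imp_def)
  then show ?case by (intro exI[of _ "Atom a"]) simp
next
  case (Neg F)
  then obtain G where "first_order G" "prv \<Gamma> (Iff F G)" by blast
  then show ?case
    by (intro exI[of _ "Neg G"] conjI prv_prop[of _ "[Iff F G]"])
      (auto simp: prop_consequence_def Iff_def Imp_def)
next
  case (And F1 F2)
  then obtain G1 G2 where "first_order G1" "prv \<Gamma> (Iff F1 G1)" "first_order G2" "prv \<Gamma> (Iff F2 G2)"
    by blast
  then show ?case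
    by (intro exI[of _ "And G1 G2"] conjI prv_prop[of _ "[Iff F1 G1, Iff F2 G2]"])
      (auto simp: prop_consequence_def Iff_def Imp_def)
next
  case (All v F)
  then obtain G where "first_order G" "prv \<Gamma> (Iff F G)" by blast
  then show ?case
    by (intro exI[of _ "All v G"]) (simp add: prv_All_cong)
next
  case (Box p F)
  then obtain G where G: "first_order G" "prv \<Gamma> (Iff F G)" by blast
  obtain \<chi> where \<chi>: "first_order \<chi>" "valid \<Delta> (Iff \<chi> (Box p G))"
    using definable[OF G(1)] by blast
  have "prv \<Gamma> (Imp \<chi> (Box p G))"
    using \<chi> G(1) by (intro box) (auto simp: valid_def)
  \<comment> \<open>The contrapositive of this supplies the direction from the box to
    \<chi>.\<close>
  moreover have "prv \<Gamma> (Imp (Neg \<chi>) (Dia p (Neg G)))"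
    using \<chi> G(1) by (intro dia) (auto simp: valid_def)
  moreover have "prv \<Gamma> (Iff (Box p F) (Box p G))"
    by (rule prv_Box_cong[OF G(2)])
  \<comment> \<open>The diamond unfolds to a negated box over a double negation. Boxes are opaque to
    propositional reasoning, so the double negation has to be removed by congruence.\<close>
  moreover have "prv \<Gamma> (Iff (Box p G) (Box p (Neg (Neg G))))"
    by (intro prv_Box_cong prv_prop[of _ "[]"]) (auto simp: prop_consequence_def Iff_def Imp_def)
  ultimately have prems: "list_all (prv \<Gamma>) [Imp \<chi> (Box p G), Imp (Neg \<chi>) (Dia p (Neg G)),
      Iff (Box p F) (Box p G), Iff (Box p G) (Box p (Neg (Neg G)))]"
    by simp
  have "prv \<Gamma> (Iff (Box p F) \<chi>)"
  proof (rule prv_prop[OF prems], unfold prop_consequence_def, intro allI impI, elim conjE)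
    fix h :: "('v, 'a, 'p) fml \<Rightarrow> bool"
    assume h: "\<forall>G. h (Neg G) \<longleftrightarrow> \<not> h G" "\<forall>G H. h (And G H) \<longleftrightarrow> h G \<and> h H"
      and "\<forall>G\<in>set [Imp \<chi> (Box p G), Imp (Neg \<chi>) (Dia p (Neg G)),
        Iff (Box p F) (Box p G), Iff (Box p G) (Box p (Neg (Neg G)))]. h G"
    then show "h (Iff (Box p F) \<chi>)"
      unfolding Iff_def Imp_def Dia_def list.set ball_simps h[rule_format] by blast
  qed
  then show ?case
    using \<chi>(1) by blast
qed

end

theorem mainTheorem17:
  fixes \<Delta> :: "('v, 'a, 'p, 'u, 's) dyn_theory"
    and BVP :: "'p \<Rightarrow> 'v set"
    and eq :: "'v \<Rightarrow> 'v \<Rightarrow> ('v, 'a, 'p) fml"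
    and S :: "'p \<Rightarrow> 'v list \<Rightarrow> 'v list \<Rightarrow> ('v, 'a, 'p) fml"
    and prv :: "('v, 'a, 'p) fml set \<Rightarrow> ('v, 'a, 'p) fml \<Rightarrow> bool"
  assumes expressive: "fol_expressive \<Delta> BVP eq S"
    and calculus: "proof_calculus \<Delta> prv"
    and box_complete:
      "\<And>\<phi> \<psi> p. first_order \<phi> \<Longrightarrow> first_order \<psi> \<Longrightarrow> valid \<Delta> (Imp \<phi> (Box p \<psi>)) \<Longrightarrow>
        prv (fo_validities \<Delta>) (Imp \<phi> (Box p \<psi>))"
    and dia_complete:
      "\<And>\<phi> \<psi> p. first_order \<phi> \<Longrightarrow> first_order \<psi> \<Longrightarrow> valid \<Delta> (Imp \<phi> (Dia p \<psi>)) \<Longrightarrow>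
        prv (fo_validities \<Delta>) (Imp \<phi> (Dia p \<psi>))"
  shows "\<And>F. valid \<Delta> F \<Longrightarrow> prv (fo_validities \<Delta>) F"
proof -
  fix F :: "('v, 'a, 'p) fml"
  assume F: "valid \<Delta> F"
  interpret fol_expressive \<Delta> BVP eq S by (rule expressive)
  interpret proof_calculus \<Delta> prv by (rule calculus)
  obtain G where G: "first_order G" "prv (fo_validities \<Delta>) (Iff F G)"
    using prv_Iff_first_order[OF Box_first_order_definable box_complete dia_complete] by blast
  \<comment> \<open>Soundness transfers the validity of \<open>F\<close> to \<open>G\<close>, so
    that \<open>G\<close> itself becomes an admissible axiom.\<close>
  have "valid \<Delta> (Iff F G)"
    by (rule sound[OF G(2)]) (simp add: fo_validities_def)
  then have "G \<in> fo_validities \<Delta>"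
    using F G(1) by (simp add: fo_validities_def valid_def)
  then show "prv (fo_validities \<Delta>) F"
    using G(2) by (intro prv_prop[of _ "[Iff F G, G]"])
      (auto simp: assumption prop_consequence_def Iff_def Imp_def)
qed

end
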